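(* If $k$ is a positive integer and $G$ is an arbitrary finite simple graph, then $\gamma_{{\rm ri}k}(G)=i(G\,\Box\, K_k)$.
   Context: All graphs are finite and simple. For a positive integer $k$, a $k$-rainbow independent dominating function of a graph $G$ is a function $f\colon V(G)\to\{0,1,\ldots,k\}$ such that, with $V_i=\{x\in V(G): f(x)=i\}$, (1) $V_i$ is an independent set for every $1\le i\le k$, and (2) for every $x\in V_0$ and every $i\in\{1,\ldots,k\}$, $N(x)\cap V_i\neq\emptyset$. Its weight is $\sum_{i=1}^k|V_i|$. The $k$-rainbow independent domination number $\gamma_{{\rm ri}k}(G)$ is the minimum weight of such a function. $i(H)$ denotes the independent domination number of a graph $H$, i.e. the minimum cardinality of a set that is both independent and dominating in $H$. $G\,\Box\, H$ is the Cartesian product: its vertex set is $V(G)\times V(H)$, and $(g,h)$, $(g',h')$ are adjacent iff ($gg'\in E(G)$ and $h=h'$) or ($g=g'$ and $hh'\in E(H)$). $K_k$ is the complete graph on $k$ vertices. *)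

theory Defs
  imports "Graph_Theory.Graph_Theory"
begin

text \<open>
  A finite simple graph is a \<^locale>\<open>graph\<close>, that is, a finite loop-free digraph without
  parallel arcs whose adjacency relation is symmetric. Every undirected edge is thus a pair of
  opposite arcs, and \<open>u \<rightarrow>\<^bsub>G\<^esub> v\<close> (the abbreviation \<open>dominates\<close> of the library) is adjacency of
  \<open>u\<close> and \<open>v\<close>, not domination in the sense of this theory.
\<close>

definition neighbourhood :: "('a, 'b) pre_digraph \<Rightarrow> 'a \<Rightarrow> 'a set" where
  "neighbourhood G x = {y \<in> verts G. x \<rightarrow>\<^bsub>G\<^esub> y}"

definition independent_set :: "('a, 'b) pre_digraph \<Rightarrow> 'a set \<Rightarrow> bool" where
  "independent_set G S \<longleftrightarrow> S \<subseteq> verts G \<and> (\<forall>u\<in>S. \<forall>v\<in>S. \<not> u \<rightarrow>\<^bsub>G\<^esub> v)"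

definition dominating_set :: "('a, 'b) pre_digraph \<Rightarrow> 'a set \<Rightarrow> bool" where
  "dominating_set G S \<longleftrightarrow> S \<subseteq> verts G \<and> (\<forall>x\<in>verts G - S. neighbourhood G x \<inter> S \<noteq> {})"

definition independent_domination_number :: "('a, 'b) pre_digraph \<Rightarrow> nat" where
  "independent_domination_number G =
     (LEAST n. \<exists>S. independent_set G S \<and> dominating_set G S \<and> card S = n)"

definition colour_class :: "('a, 'b) pre_digraph \<Rightarrow> ('a \<Rightarrow> nat) \<Rightarrow> nat \<Rightarrow> 'a set" where
  "colour_class G f i = {x \<in> verts G. f x = i}"

text \<open>Values of \<open>f\<close> outside \<^term>\<open>verts G\<close> are unconstrained and irrelevant.\<close>

definition rainbow_independent_dominating ::
  "nat \<Rightarrow> ('a, 'b) pre_digraph \<Rightarrow> ('a \<Rightarrow> nat) \<Rightarrow> bool" where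
  "rainbow_independent_dominating k G f \<longleftrightarrow>
     f \<in> verts G \<rightarrow> {0..k} \<and>
     (\<forall>i\<in>{1..k}. independent_set G (colour_class G f i)) \<and>
     (\<forall>x\<in>colour_class G f 0. \<forall>i\<in>{1..k}. neighbourhood G x \<inter> colour_class G f i \<noteq> {})"

definition rainbow_weight :: "nat \<Rightarrow> ('a, 'b) pre_digraph \<Rightarrow> ('a \<Rightarrow> nat) \<Rightarrow> nat" where
  "rainbow_weight k G f = (\<Sum>i=1..k. card (colour_class G f i))"

definition rainbow_independent_domination_number ::
  "nat \<Rightarrow> ('a, 'b) pre_digraph \<Rightarrow> nat" where
  "rainbow_independent_domination_number k G =
     (LEAST n. \<exists>f. rainbow_independent_dominating k G f \<and> rainbow_weight k G f = n)"

definition cartesian_product ::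
  "('a, 'b) pre_digraph \<Rightarrow> ('c, 'd) pre_digraph \<Rightarrow> ('a \<times> 'c, ('a \<times> 'c) \<times> 'a \<times> 'c) pre_digraph"
  (infixr \<open>\<box>\<close> 70) where
  "G \<box> H = with_proj
     \<lparr> pverts = verts G \<times> verts H,
       parcs = {((g, h), (g', h')) | g h g' h'.
         (g, h) \<in> verts G \<times> verts H \<and> (g', h') \<in> verts G \<times> verts H \<and>
         (g \<rightarrow>\<^bsub>G\<^esub> g' \<and> h = h' \<or> g = g' \<and> h \<rightarrow>\<^bsub>H\<^esub> h')} \<rparr>"

text \<open>
  Both minima are taken over nonempty sets, so \<open>LEAST\<close> denotes an attained value; and the
  product of two graphs is again a graph.
\<close>

lemma independent_dominating_set_exists:
  assumes "graph G"
  shows "\<exists>S. independent_set G S \<and> dominating_set G S"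
proof -
  interpret graph G by fact
  let ?P = "\<lambda>S. independent_set G S"
  have e: "?P {}" by (simp add: independent_set_def)
  have b: "\<forall>S. ?P S \<longrightarrow> card S < Suc (card (verts G))"
    by (auto simp: independent_set_def less_Suc_eq_le intro: card_mono)
  obtain S where S: "?P S" and m: "\<And>T. ?P T \<Longrightarrow> card T \<le> card S"
    using ex_has_greatest_nat[of ?P "{}" card, OF e b] by blast
  have fin: "finite S"
    using S finite_subset[OF _ finite_verts] by (auto simp: independent_set_def)
  have "neighbourhood G x \<inter> S \<noteq> {}" if x: "x \<in> verts G - S" for x
  proof
    assume "neighbourhood G x \<inter> S = {}"
    then have n: "\<not> x \<rightarrow>\<^bsub>G\<^esub> s" if "s \<in> S" for s
      using S that by (auto simp: neighbourhood_def independent_set_def)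
    then have "\<not> s \<rightarrow>\<^bsub>G\<^esub> x" if "s \<in> S" for s
      using arcs_ends_symmetric[OF sym_arcs] that by blast
    then have "?P (insert x S)"
      using S x n by (auto simp: independent_set_def dest: adj_not_same)
    then show False using m[of "insert x S"] x fin by simp
  qed
  then show ?thesis using S by (auto simp: dominating_set_def independent_set_def)
qed

lemma rainbow_independent_dominating_exists:
  assumes "graph G"
  shows "\<exists>f. rainbow_independent_dominating k G f"
proof -
  interpret graph G by fact
  let ?P = "\<lambda>f. f \<in> verts G \<rightarrow> {0..k} \<and> (\<forall>i\<in>{1..k}. independent_set G (colour_class G f i))"
  let ?w = "\<lambda>f. card {x \<in> verts G. f x \<noteq> (0::nat)}"
  have e: "?P (\<lambda>_. 0)" by (auto simp: independent_set_def colour_class_def)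
  have b: "\<forall>f. ?P f \<longrightarrow> ?w f < Suc (card (verts G))"
    by (auto simp: less_Suc_eq_le intro!: card_mono)
  obtain f where f: "?P f" and m: "\<And>g. ?P g \<Longrightarrow> ?w g \<le> ?w f"
    using ex_has_greatest_nat[of ?P "\<lambda>_. 0" ?w, OF e b] by blast
  have "neighbourhood G x \<inter> colour_class G f i \<noteq> {}"
    if x: "x \<in> colour_class G f 0" and i: "i \<in> {1..k}" for x i
  proof
    assume a: "neighbourhood G x \<inter> colour_class G f i = {}"
    have xv: "x \<in> verts G" "f x = 0" using x by (auto simp: colour_class_def)
    have n: "\<not> x \<rightarrow>\<^bsub>G\<^esub> s" if "s \<in> colour_class G f i" for s
      using a that by (auto simp: neighbourhood_def colour_class_def)
    then have n': "\<not> s \<rightarrow>\<^bsub>G\<^esub> x" if "s \<in> colour_class G f i" for s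
      using arcs_ends_symmetric[OF sym_arcs] that by blast
    let ?g = "f(x := i)"
    have "independent_set G (colour_class G ?g j)" if j: "j \<in> {1..k}" for j
    proof (cases "j = i")
      case True
      have "colour_class G ?g i = insert x (colour_class G f i)"
        using xv by (auto simp: colour_class_def)
      then show ?thesis using True f i xv n n'
        by (auto simp: independent_set_def dest: adj_not_same)
    next
      case False
      then have "colour_class G ?g j = colour_class G f j"
        using xv j by (auto simp: colour_class_def)
      then show ?thesis using f j by simp
    qed
    then have "?P ?g" using f i by (auto simp: Pi_iff)
    moreover have "{y \<in> verts G. ?g y \<noteq> 0} = insert x {y \<in> verts G. f y \<noteq> 0}"
      using xv i by auto
    then have "?w ?g = Suc (?w f)" using xv by simp
    ultimately show False using m[of ?g] by simp
  qed
  then show ?thesis using f by (auto simp: rainbow_independent_dominating_def)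
qed

lemma verts_cartesian_product: "verts (G \<box> H) = verts G \<times> verts H"
  by (simp add: cartesian_product_def)

lemma graph_cartesian_product:
  assumes "graph G" "graph H"
  shows "graph (G \<box> H)"
proof -
  interpret G: graph G by fact
  interpret H: graph H by fact
  let ?P = "\<lparr> pverts = verts G \<times> verts H,
       parcs = {((g, h), (g', h')) | g h g' h'.
         (g, h) \<in> verts G \<times> verts H \<and> (g', h') \<in> verts G \<times> verts H \<and>
         (g \<rightarrow>\<^bsub>G\<^esub> g' \<and> h = h' \<or> g = g' \<and> h \<rightarrow>\<^bsub>H\<^esub> h')} \<rparr>"
  have "finite (parcs ?P)"
    by (rule finite_subset[of _ "(verts G \<times> verts H) \<times> (verts G \<times> verts H)"]) auto
  moreover have "sym (parcs ?P)"
    using arcs_ends_symmetric[OF G.sym_arcs] arcs_ends_symmetric[OF H.sym_arcs]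
    by (auto simp: sym_def)
  ultimately interpret pair_graph ?P
    by unfold_locales (auto simp: symmetric_def dest: G.adj_not_same H.adj_not_same)
  show ?thesis unfolding cartesian_product_def by unfold_locales
qed

end

theory Submission
  imports Defs
begin

text \<open>
  A partial colouring \<open>f\<close> of \<open>G\<close> corresponds to its graph, the set of pairs \<open>(x, f x)\<close> with
  \<open>f x \<noteq> 0\<close>, in \<open>G \<box> K\<^sub>k\<close>. An independent set meets every \<open>K\<^sub>k\<close>-fibre in at most one vertex, so
  every independent set arises in this way. In a fibre that the set meets, domination is automatic;
  in a fibre over \<open>x\<close> with \<open>f x = 0\<close>, it says that \<open>x\<close> sees every colour.
\<close>

lemma dominates_cartesian_product:
  "(g, h) \<rightarrow>\<^bsub>G \<box> H\<^esub> (g', h') \<longleftrightarrow>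
     g \<in> verts G \<and> h \<in> verts H \<and> g' \<in> verts G \<and> h' \<in> verts H \<and>
     (g \<rightarrow>\<^bsub>G\<^esub> g' \<and> h = h' \<or> g = g' \<and> h \<rightarrow>\<^bsub>H\<^esub> h')"
  by (auto simp: cartesian_product_def arcs_ends_def arc_to_ends_def)

lemma dominates_complete_digraph:
  assumes "complete_digraph k K"
  shows "u \<rightarrow>\<^bsub>K\<^esub> v \<longleftrightarrow> u \<in> verts K \<and> v \<in> verts K \<and> u \<noteq> v"
  using assms by (auto simp: complete_digraph_def)

text \<open>The map \<open>c\<close> carries colours to vertices of an arbitrary complete graph,
  whose vertices need not be numbers; later it is a bijection from \<open>{1..k}\<close>.\<close>

definition colouring_graph ::
  "('a, 'b) pre_digraph \<Rightarrow> (nat \<Rightarrow> 'c) \<Rightarrow> ('a \<Rightarrow> nat) \<Rightarrow> ('a \<times> 'c) set" where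
  "colouring_graph G c f = {(x, c (f x)) | x. x \<in> verts G \<and> f x \<noteq> 0}"

text \<open>The first coordinate determines a pair of the graph, so pairs correspond to coloured
  vertices, and these split into the disjoint classes \<open>1..k\<close>.\<close>

lemma card_colouring_graph:
  assumes "finite (verts G)" and "f \<in> verts G \<rightarrow> {0..k}"
  shows "card (colouring_graph G c f) = rainbow_weight k G f"
proof -
  have "colouring_graph G c f = (\<lambda>x. (x, c (f x))) ` (\<Union>i\<in>{1..k}. colour_class G f i)"
    using assms(2) by (force simp: colouring_graph_def colour_class_def)
  then have "card (colouring_graph G c f) = card (\<Union>i\<in>{1..k}. colour_class G f i)"
    by (simp add: card_image inj_on_def)
  also have "\<dots> = (\<Sum>i\<in>{1..k}. card (colour_class G f i))"
    using assms(1) by (intro card_UN_disjoint) (auto simp: colour_class_def)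
  finally show ?thesis by (simp add: rainbow_weight_def)
qed

lemma rainbow_independent_dominating_iff:
  assumes K: "complete_digraph k K"
    and c: "bij_betw c {1..k} (verts K)"
    and f: "f \<in> verts G \<rightarrow> {0..k}"
  shows "rainbow_independent_dominating k G f \<longleftrightarrow>
    independent_set (G \<box> K) (colouring_graph G c f) \<and>
    dominating_set (G \<box> K) (colouring_graph G c f)"
    (is "_ \<longleftrightarrow> independent_set ?P ?S \<and> _")
proof
  note adj = dominates_cartesian_product dominates_complete_digraph[OF K]
  have colour: "f x \<in> {1..k}" if "x \<in> verts G" "f x \<noteq> 0" for x
    using f that by (force simp: Pi_iff)
  have cK: "c i \<in> verts K" if "i \<in> {1..k}" for i
    using c that by (auto simp: bij_betw_def)
  have inj: "i = j" if "c i = c j" "i \<in> {1..k}" "j \<in> {1..k}" for i j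
    using bij_betw_imp_inj_on[OF c] that by (rule inj_onD)
  have sub: "?S \<subseteq> verts ?P"
    using colour cK by (auto simp: colouring_graph_def verts_cartesian_product)
  {
    assume r: "rainbow_independent_dominating k G f"
    have "\<not> (x, c (f x)) \<rightarrow>\<^bsub>?P\<^esub> (y, c (f y))"
      if x: "x \<in> verts G" "f x \<noteq> 0" and y: "y \<in> verts G" "f y \<noteq> 0" for x y
    proof
      assume "(x, c (f x)) \<rightarrow>\<^bsub>?P\<^esub> (y, c (f y))"
      \<comment> \<open>An edge inside a fibre would give \<open>x = y\<close>, hence a loop at
        \<open>c (f x)\<close> in \<open>K\<close>. So the edge comes from \<open>G\<close>, and
        injectivity of \<open>c\<close> turns equal second coordinates into equal colours.\<close>
      then have "x \<rightarrow>\<^bsub>G\<^esub> y" "f x = f y"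
        using inj colour x y by (auto simp: adj)
      moreover have "independent_set G (colour_class G f (f x))"
        using r colour[OF x] by (simp add: rainbow_independent_dominating_def)
      ultimately show False
        using x y by (simp add: independent_set_def colour_class_def)
    qed
    then have "independent_set ?P ?S"
      using sub by (auto simp: independent_set_def colouring_graph_def)
    moreover have "neighbourhood ?P p \<inter> ?S \<noteq> {}" if p: "p \<in> verts ?P - ?S" for p
    proof -
      obtain x i where xi: "p = (x, c i)" "x \<in> verts G" "i \<in> {1..k}"
        using p bij_betw_imp_surj_on[OF c, symmetric] by (auto simp: verts_cartesian_product)
      show ?thesis
      proof (cases "f x = 0")
        case True
        then have "neighbourhood G x \<inter> colour_class G f i \<noteq> {}"
          using r xi by (auto simp: rainbow_independent_dominating_def colour_class_def)
        then obtain y where y: "y \<in> verts G" "x \<rightarrow>\<^bsub>G\<^esub> y" "f y = i"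
          by (auto simp: neighbourhood_def colour_class_def)
        \<comment> \<open>Here \<open>i\<close> is at least 1, so \<open>y\<close> is coloured and
          contributes a pair.\<close>
        then have "(y, c i) \<in> ?S" using xi by (auto simp: colouring_graph_def)
        moreover have "p \<rightarrow>\<^bsub>?P\<^esub> (y, c i)" using xi y cK by (auto simp: adj)
        ultimately show ?thesis using sub by (auto simp: neighbourhood_def)
      next
        case False
        then have s: "(x, c (f x)) \<in> ?S" using xi by (auto simp: colouring_graph_def)
        \<comment> \<open>Since \<open>p\<close> lies outside the set, \<open>c i\<close> differs
          from \<open>c (f x)\<close>, and distinct points of a fibre are adjacent.\<close>
        then have "p \<rightarrow>\<^bsub>?P\<^esub> (x, c (f x))"
          using p xi cK colour[OF xi(2) False] by (auto simp: adj)
        then show ?thesis using s sub by (auto simp: neighbourhood_def)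
      qed
    qed
    ultimately show "independent_set ?P ?S \<and> dominating_set ?P ?S"
      using sub by (auto simp: dominating_set_def)
  }
  assume S: "independent_set ?P ?S \<and> dominating_set ?P ?S"
  have "\<not> x \<rightarrow>\<^bsub>G\<^esub> y"
    if i: "i \<in> {1..k}" and x: "x \<in> colour_class G f i" and y: "y \<in> colour_class G f i" for i x y
  proof -
    have "(x, c i) \<in> ?S" "(y, c i) \<in> ?S"
      using i x y by (auto simp: colouring_graph_def colour_class_def)
    then have "\<not> (x, c i) \<rightarrow>\<^bsub>?P\<^esub> (y, c i)"
      using S by (auto simp: independent_set_def)
    then show ?thesis
      using i x y cK by (auto simp: adj colour_class_def)
  qed
  moreover have "neighbourhood G x \<inter> colour_class G f i \<noteq> {}"
    if x: "x \<in> colour_class G f 0" and i: "i \<in> {1..k}" for x i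
  proof -
    \<comment> \<open>The fibre over an uncoloured \<open>x\<close> contains no point of the set, so
      each \<open>(x, c i)\<close> must be dominated from outside it.\<close>
    have "(x, c i) \<in> verts ?P - ?S"
      using x cK[OF i] by (auto simp: colouring_graph_def colour_class_def verts_cartesian_product)
    then have "neighbourhood ?P (x, c i) \<inter> ?S \<noteq> {}"
      using S by (auto simp: dominating_set_def)
    then obtain y where y: "y \<in> verts G" "f y \<noteq> 0" "(x, c i) \<rightarrow>\<^bsub>?P\<^esub> (y, c (f y))"
      by (auto simp: neighbourhood_def colouring_graph_def)
    \<comment> \<open>As \<open>f y\<close> is nonzero and \<open>f x\<close> is zero,
      \<open>x\<close> and \<open>y\<close> differ; this excludes an edge within the fibre.\<close>
    then have "x \<rightarrow>\<^bsub>G\<^esub> y" "c i = c (f y)"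
      using x by (auto simp: adj colour_class_def)
    then show ?thesis
      using y i inj[OF _ i colour[OF y(1,2)]] by (auto simp: neighbourhood_def colour_class_def)
  qed
  ultimately show "rainbow_independent_dominating k G f"
    using f by (auto simp: rainbow_independent_dominating_def independent_set_def colour_class_def)
qed

lemma independent_set_colouring_graph:
  assumes K: "complete_digraph k K"
    and c: "bij_betw c {1..k} (verts K)"
    and S: "independent_set (G \<box> K) S"
  obtains f where "f \<in> verts G \<rightarrow> {0..k}" and "S = colouring_graph G c f"
proof -
  \<comment> \<open>The value 0 marks the fibres that \<open>S\<close> misses. On the others the
    choice is forced, by \<open>uniq\<close> below and the injectivity of \<open>c\<close>.\<close>
  define f where
    "f x = (if \<exists>i\<in>{1..k}. (x, c i) \<in> S then SOME i. i \<in> {1..k} \<and> (x, c i) \<in> S else 0)" for x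
  have some: "f x \<in> {1..k} \<and> (x, c (f x)) \<in> S" if "i \<in> {1..k}" "(x, c i) \<in> S" for x i
  proof -
    have "f x = (SOME i. i \<in> {1..k} \<and> (x, c i) \<in> S)" using that by (auto simp: f_def)
    then show ?thesis
      using someI[of "\<lambda>i. i \<in> {1..k} \<and> (x, c i) \<in> S" i] that by simp
  qed
  have sub: "S \<subseteq> verts G \<times> verts K"
    using S by (simp add: independent_set_def verts_cartesian_product)
  have uniq: "h = h'" if "(x, h) \<in> S" "(x, h') \<in> S" for x h h'
  proof -
    have "\<not> (x, h) \<rightarrow>\<^bsub>G \<box> K\<^esub> (x, h')"
      using S that unfolding independent_set_def by blast
    then show ?thesis
      using that sub by (auto simp: dominates_cartesian_product dominates_complete_digraph[OF K])
  qed
  have "f x \<in> {0..k}" for x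
  proof (cases "\<exists>i\<in>{1..k}. (x, c i) \<in> S")
    case True
    then show ?thesis using some by force
  qed (simp add: f_def)
  moreover have "S \<subseteq> colouring_graph G c f"
  proof
    fix p assume p: "p \<in> S"
    then obtain x i where xi: "p = (x, c i)" "x \<in> verts G" "i \<in> {1..k}"
      using sub bij_betw_imp_surj_on[OF c, symmetric] by auto
    then have "f x \<in> {1..k}" "(x, c (f x)) \<in> S" using some p by blast+
    \<comment> \<open>The chosen colour may be compared with \<open>i\<close> only through
      \<open>S\<close>: both points lie in the fibre over \<open>x\<close>, so they
      coincide.\<close>
    moreover from this have "c (f x) = c i" using uniq p xi by blast
    ultimately show "p \<in> colouring_graph G c f" using xi by (force simp: colouring_graph_def)
  qed
  moreover have "colouring_graph G c f \<subseteq> S"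
  proof
    fix p assume "p \<in> colouring_graph G c f"
    then obtain x where x: "p = (x, c (f x))" "f x \<noteq> 0" by (auto simp: colouring_graph_def)
    \<comment> \<open>A nonzero value rules out the default branch, so \<open>S\<close> meets this
      fibre and \<open>some\<close> applies.\<close>
    then obtain i where "i \<in> {1..k}" "(x, c i) \<in> S" by (auto simp: f_def split: if_splits)
    then show "p \<in> S" using some x by blast
  qed
  ultimately show thesis by (intro that[of f]) auto
qed

theorem proposition2p4:
  fixes G :: "('a, 'b) pre_digraph" and K :: "('c, 'd) pre_digraph" and k :: nat
  assumes "k \<ge> 1"
    and "graph G"
    and "complete_digraph k K"
  shows "rainbow_independent_domination_number k G = independent_domination_number (G \<box> K)"
proof -
  interpret G: graph G by fact
  have "graph K" and k: "card (verts K) = k"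
    using assms(3) by (auto simp: complete_digraph_def)
  then interpret K: graph K by simp
  obtain c where c: "bij_betw c {1..k} (verts K)"
    using ex_bij_betw_nat_finite_1[OF K.finite_verts] k by auto
  \<comment> \<open>Both numbers are \<open>LEAST\<close> of such a predicate, so it suffices that
    the same values \<open>n\<close> occur on both sides; no minimiser has to be chosen.\<close>
  have "(\<exists>f. rainbow_independent_dominating k G f \<and> rainbow_weight k G f = n) \<longleftrightarrow>
        (\<exists>S. independent_set (G \<box> K) S \<and> dominating_set (G \<box> K) S \<and> card S = n)"
    (is "?L \<longleftrightarrow> ?R") for n
  proof
    assume ?L
    then obtain f where f: "rainbow_independent_dominating k G f" "rainbow_weight k G f = n"
      by blast
    then have "f \<in> verts G \<rightarrow> {0..k}" by (simp add: rainbow_independent_dominating_def)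
    then show ?R
      using f rainbow_independent_dominating_iff[OF assms(3) c]
        card_colouring_graph[OF G.finite_verts] by blast
  next
    assume ?R
    then obtain S where S: "independent_set (G \<box> K) S" "dominating_set (G \<box> K) S" "card S = n"
      by blast
    obtain f where f: "f \<in> verts G \<rightarrow> {0..k}" "S = colouring_graph G c f"
      using independent_set_colouring_graph[OF assms(3) c S(1)] .
    then show ?L
      using S rainbow_independent_dominating_iff[OF assms(3) c f(1)]
        card_colouring_graph[OF G.finite_verts f(1), of c] by auto
  qed
  then show ?thesis
    by (simp add: rainbow_independent_domination_number_def independent_domination_number_def)
qed

end
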